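(* (Chui's conjecture.) For an integer $n \ge 1$ and $a = (a_1,\dots,a_n) \in \mathbb{C}^n$ with $|a_k| = 1$ for $k = 1,\dots,n$, define $$I_n(a) = \int_{|z|\le 1} \left| \sum_{k=1}^n \frac{1}{z-a_k} \right| dA .$$ Then for every integer $n \ge 1$, $I_n$ attains its minimum over all such $a$ at the equispaced configuration $$a_k = \exp(2k\pi i/n), \quad k = 1,\dots,n .$$
   Context: $dA$ denotes area (two-dimensional Lebesgue) measure on $\mathbb{C}$. The points $a_k$ are not required to be distinct. *)

theory Defs
  imports "HOL-Analysis.Analysis"
begin

text \<open>
  A configuration \<open>(a\<^sub>1, \<dots>, a\<^sub>n)\<close> is a function on the naturals of which only the values at
  \<open>1, \<dots>, n\<close> matter. At the finitely many points \<open>z = a\<^sub>k\<close> the convention \<open>1 / 0 = 0\<close> applies;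
  these form a null set.
\<close>

definition unit_config :: "nat \<Rightarrow> (nat \<Rightarrow> complex) \<Rightarrow> bool" where
  "unit_config n a \<longleftrightarrow> (\<forall>k\<in>{1..n}. norm (a k) = 1)"

definition chui_integral :: "nat \<Rightarrow> (nat \<Rightarrow> complex) \<Rightarrow> real" where
  "chui_integral n a =
     (LINT z:cball 0 1|lborel. norm (\<Sum>k = 1..n. 1 / (z - a k)))"

definition equispaced :: "nat \<Rightarrow> nat \<Rightarrow> complex" where
  "equispaced n k = exp (2 * of_nat k * of_real pi * \<i> / of_nat n)"

text \<open>
  The Bochner integral of a non-integrable function is \<open>0\<close> by convention. The integrand of
  \<open>chui_integral\<close> is always integrable, so this convention is never used.
\<close>

lemma inverse_norm_le_dyadic_sum:
  fixes z :: complex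
  shows "ennreal (indicator (cball 0 2) z * (1 / norm z))
    \<le> (\<Sum>k. ennreal (2 ^ k) * indicator (cball 0 (2 / 2 ^ k)) z)"
proof (cases "z = 0 \<or> z \<notin> cball 0 2")
  case True
  then show ?thesis by auto
next
  case False
  then have z: "norm z > 0" "norm z \<le> 2" by auto
  define P where "P k \<longleftrightarrow> norm z > 2 / 2 ^ Suc k" for k :: nat
  have "\<exists>k. P k"
  proof -
    obtain k where "(1/2::real) ^ k < norm z"
      using real_arch_pow_inv[OF z(1), of "1/2"] by auto
    then have "P k" by (simp add: P_def power_divide)
    then show ?thesis ..
  qed
  define k where "k = (LEAST k. P k)"
  have Pk: "P k" unfolding k_def using \<open>\<exists>k. P k\<close> by (rule LeastI_ex)
  have le: "norm z \<le> 2 / 2 ^ k"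
  proof (cases k)
    case 0
    then show ?thesis using z by simp
  next
    case (Suc j)
    then have "\<not> P j" using not_less_Least[of j P] by (simp add: k_def)
    then show ?thesis using Suc by (simp add: P_def)
  qed
  have "1 / norm z \<le> 2 ^ k"
    using Pk z by (simp add: P_def field_simps)
  then have "ennreal (indicator (cball 0 2) z * (1 / norm z))
      \<le> ennreal (2 ^ k) * indicator (cball 0 (2 / 2 ^ k)) z"
    using z le by (simp add: ennreal_leI)
  also have "\<dots> \<le> (\<Sum>j. ennreal (2 ^ j) * indicator (cball 0 (2 / 2 ^ j)) z)"
  proof -
    have "f k \<le> suminf f" for f :: "nat \<Rightarrow> ennreal"
      using sum_le_suminf[of f "{k}"] by simp
    then show ?thesis .
  qed
  finally show ?thesis .
qed

lemma borel_measurable_inverse_norm: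
  "(\<lambda>z::complex. indicat_real (cball 0 2) z * (1 / norm z)) \<in> borel_measurable borel"
    by (intro borel_measurable_times borel_measurable_indicator borel_measurable_divide
        borel_measurable_const borel_measurable_norm measurable_ident) auto

lemma integrable_inverse_norm:
  "integrable lborel (\<lambda>z::complex. indicator (cball 0 2) z * (1 / norm z))"
proof (rule integrableI_bounded)
  show "(\<lambda>z::complex. indicator (cball 0 2) z * (1 / norm z)) \<in> borel_measurable lborel"
    using borel_measurable_inverse_norm by simp
  have "(\<integral>\<^sup>+z. ennreal (norm (indicator (cball 0 2) z * (1 / norm z))) \<partial>(lborel :: complex measure))
      = (\<integral>\<^sup>+z. ennreal (indicator (cball 0 2) z * (1 / norm z)) \<partial>(lborel :: complex measure))"
    by (rule nn_integral_cong) (simp add: abs_mult)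
  also have "\<dots> \<le> (\<integral>\<^sup>+z. (\<Sum>k. ennreal (2 ^ k) * indicator (cball 0 (2 / 2 ^ k)) z) \<partial>(lborel :: complex measure))"
    by (rule nn_integral_mono) (rule inverse_norm_le_dyadic_sum)
  also have "\<dots> = (\<Sum>k. \<integral>\<^sup>+z. ennreal (2 ^ k) * indicator (cball 0 (2 / 2 ^ k)) z \<partial>(lborel :: complex measure))"
    by (rule nn_integral_suminf)
      (intro borel_measurable_times_ennreal borel_measurable_const borel_measurable_indicator, simp)
  also have "\<dots> = (\<Sum>k. ennreal (4 * pi * (1/2) ^ k))"
  proof (rule suminf_cong)
    fix k :: nat
    have "(\<integral>\<^sup>+z. ennreal (2 ^ k) * indicator (cball 0 (2 / 2 ^ k)) z \<partial>(lborel :: complex measure))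
        = ennreal (2 ^ k) * emeasure lborel (cball (0::complex) (2 / 2 ^ k))"
      by (subst nn_integral_cmult_indicator) auto
    also have "emeasure lborel (cball (0::complex) (2 / 2 ^ k)) = ennreal (pi * (2 / 2 ^ k) ^ 2)"
      by (subst emeasure_cball) (auto simp: unit_ball_vol_2)
    also have "ennreal (2 ^ k) * ennreal (pi * (2 / 2 ^ k) ^ 2) = ennreal (4 * pi * (1/2) ^ k)"
      by (simp add: ennreal_mult[symmetric] power_divide power2_eq_square)
    finally show "(\<integral>\<^sup>+z. ennreal (2 ^ k) * indicator (cball 0 (2 / 2 ^ k)) z \<partial>(lborel :: complex measure))
        = ennreal (4 * pi * (1/2) ^ k)" .
  qed
  also have "\<dots> < \<infinity>"
    by (subst suminf_ennreal2) (auto intro!: summable_mult summable_geometric)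
  finally show "(\<integral>\<^sup>+z. ennreal (norm (indicator (cball 0 2) z * (1 / norm z))) \<partial>(lborel :: complex measure)) < \<infinity>" .
qed

lemma set_integrable_chui:
  assumes "unit_config n a"
  shows "set_integrable lborel (cball 0 1) (\<lambda>z. norm (\<Sum>k = 1..n. 1 / (z - a k)))"
proof -
  let ?g = "\<lambda>k z. indicator (cball 0 2) (- a k + z) * (1 / norm (- a k + z)) :: real"
  have int: "integrable lborel (\<lambda>z. \<Sum>k = 1..n. ?g k z)"
  proof (rule Bochner_Integration.integrable_sum)
    fix k
    show "integrable lborel (?g k)"
      using integrable_inverse_norm borel_measurable_inverse_norm
      by (subst (asm) lborel_distr_plus[of "- a k", symmetric])
        (subst (asm) integrable_distr_eq; simp)
  qed
  show ?thesis
    unfolding set_integrable_def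
  proof (rule Bochner_Integration.integrable_bound[OF int])
    show "(\<lambda>z. indicator (cball 0 1) z *\<^sub>R norm (\<Sum>k = 1..n. 1 / (z - a k)))
        \<in> borel_measurable lborel"
      unfolding measurable_lborel1
      by (intro borel_measurable_scaleR borel_measurable_indicator borel_measurable_norm
          borel_measurable_sum borel_measurable_divide borel_measurable_diff
          borel_measurable_const measurable_ident) auto
    have "norm (indicator (cball 0 1) z *\<^sub>R norm (\<Sum>k = 1..n. 1 / (z - a k)))
        \<le> norm (\<Sum>k = 1..n. ?g k z)" for z
    proof (cases "norm z \<le> 1")
      case True
      have "norm (\<Sum>k = 1..n. 1 / (z - a k)) \<le> (\<Sum>k = 1..n. norm (1 / (z - a k)))"
        by (rule norm_sum)
      also have "\<dots> = (\<Sum>k = 1..n. ?g k z)"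
      proof (rule sum.cong)
        fix k assume "k \<in> {1..n}"
        then have "norm (a k) = 1" using assms by (simp add: unit_config_def)
        then have "norm (z - a k) \<le> 2" using True norm_triangle_ineq4[of z "a k"] by simp
        then show "norm (1 / (z - a k)) = ?g k z" by (simp add: norm_divide)
      qed simp
      finally show ?thesis using True by simp
    qed simp
    then show "AE z in lborel. norm (indicator (cball 0 1) z *\<^sub>R norm (\<Sum>k = 1..n. 1 / (z - a k)))
        \<le> norm (\<Sum>k = 1..n. ?g k z)"
      by simp
  qed
qed

end

theory Submission
  imports Defs
    "HOL-Complex_Analysis.Complex_Analysis"
    "HOL-Probability.Probability_Measure"
    "HOL-Computational_Algebra.Fundamental_Theorem_Algebra"
    "HOL-Real_Asymp.Real_Asymp"
begin

text \<open>
  The equispaced configuration is optimal on every circle \<open>|w| = r < 1\<close> separately; rotation invariance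
  of area reduces the theorem to this. Put \<open>p(w) = \<Prod>\<^sub>k (w - a\<^sub>k)\<close> and
  \<open>g(w) = w p'(w) / p(w) = \<Sum>\<^sub>k w / (w - a\<^sub>k)\<close>. Since \<open>|x|\<close> is the integral of
  \<open>ln (max \<rho> |x|) - ln \<rho>\<close> over \<open>\<rho> > 0\<close>, and \<open>ln (max \<rho> |x|)\<close> is the mean of \<open>ln |\<zeta> - x|\<close>
  over \<open>|\<zeta>| = \<rho>\<close>, it suffices to minimise, for each \<open>\<zeta>\<close>, the mean of \<open>ln |\<zeta> - g(w)|\<close> over \<open>|w| = r\<close>.
  Let \<open>z\<^sub>1, \<dots>, z\<^sub>n\<close> be the roots of \<open>\<zeta> p - w p'\<close>, a polynomial with leading coefficient \<open>\<zeta> - n\<close>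
  and constant term of modulus \<open>|\<zeta>|\<close>. By Jensen's formula that mean equals
  \<open>ln |\<zeta> - n| + \<Sum>\<^sub>i ln (max r |z\<^sub>i|)\<close>, where \<open>\<Prod>\<^sub>i |z\<^sub>i| = |\<zeta>| / |\<zeta> - n|\<close> does not depend on \<open>a\<close>.
  By convexity the sum is smallest when all \<open>|z\<^sub>i|\<close> agree, as they do for \<open>p = w\<^sup>n - 1\<close>.
\<close>

section \<open>Rotations and the uniform measure on the unit circle\<close>

lemma nn_integral_lborel_shift:
  fixes f :: "'a::euclidean_space \<Rightarrow> ennreal"
  assumes "f \<in> borel_measurable borel"
  shows "(\<integral>\<^sup>+y. f (c + y) \<partial>lborel) = (\<integral>\<^sup>+y. f y \<partial>lborel)"
  using assms by (subst (2) lborel_distr_plus[of c, symmetric]) (simp add: nn_integral_distr)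

text \<open>
  As in the uniqueness proof for Haar measure: by Fubini and translation invariance,
  \<open>\<integral> g \<cdot> \<integral> f(uy) dy = \<integral>\<integral> g(x - uy) f(x) dx dy = \<integral> g \<cdot> \<integral> f\<close> for rotation-invariant \<open>g\<close>.
\<close>

lemma nn_integral_lborel_rotate:
  fixes f :: "complex \<Rightarrow> ennreal" and u :: complex
  assumes f [measurable]: "f \<in> borel_measurable borel" and u: "norm u = 1"
  shows "(\<integral>\<^sup>+y. f (u * y) \<partial>lborel) = (\<integral>\<^sup>+y. f y \<partial>lborel)"
proof -
  \<comment> \<open>The indicator of the disc is rotation invariant and its integral
    \<open>V\<close> is neither 0 nor infinite, so \<open>V\<close> can be cancelled at the
    end.\<close>
  define g :: "complex \<Rightarrow> ennreal" where "g = indicator (cball 0 1)"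
  have [measurable]: "g \<in> borel_measurable borel" unfolding g_def by (intro borel_measurable_indicator) simp
  have u0: "u \<noteq> 0" using u by auto
  define V where "V = (\<integral>\<^sup>+x. g x \<partial>lborel)"
  have V: "V = ennreal pi"
    unfolding V_def g_def by (simp add: emeasure_cball unit_ball_vol_2)
  have inner: "(\<integral>\<^sup>+y. g (x - u * y) \<partial>lborel) = V" for x
  proof -
    \<comment> \<open>Shifting \<open>y\<close> by \<open>x / u\<close> turns
      \<open>x - u * y\<close> into \<open>- u * y\<close>, which has the norm of
      \<open>y\<close>.\<close>
    have "(\<integral>\<^sup>+y. g (x - u * y) \<partial>lborel) = (\<integral>\<^sup>+y. g (x - u * (x / u + y)) \<partial>lborel)"
      by (rule nn_integral_lborel_shift[symmetric]) measurable
    also have "\<dots> = V"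
      unfolding V_def
      by (rule nn_integral_cong) (use u u0 in \<open>auto simp: g_def indicator_def algebra_simps norm_mult\<close>)
    finally show ?thesis .
  qed
  have "V * (\<integral>\<^sup>+y. f (u * y) \<partial>lborel) = (\<integral>\<^sup>+x. g x * (\<integral>\<^sup>+y. f (u * y) \<partial>lborel) \<partial>lborel)"
    unfolding V_def by (simp add: nn_integral_multc)
  also have "\<dots> = (\<integral>\<^sup>+x. g x * (\<integral>\<^sup>+y. f (x + u * y) \<partial>lborel) \<partial>lborel)"
  proof (rule nn_integral_cong)
    fix x :: complex
    have "(\<integral>\<^sup>+y. f (u * y) \<partial>lborel) = (\<integral>\<^sup>+y. f (u * (x / u + y)) \<partial>lborel)"
      by (rule nn_integral_lborel_shift[symmetric]) measurable
    then show "g x * (\<integral>\<^sup>+y. f (u * y) \<partial>lborel) = g x * (\<integral>\<^sup>+y. f (x + u * y) \<partial>lborel)"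
      using u0 by (simp add: distrib_left)
  qed
  also have "\<dots> = (\<integral>\<^sup>+x. (\<integral>\<^sup>+y. g x * f (x + u * y) \<partial>lborel) \<partial>lborel)"
    by (intro nn_integral_cong nn_integral_cmult[symmetric]) measurable
  also have "\<dots> = (\<integral>\<^sup>+y. (\<integral>\<^sup>+x. g x * f (x + u * y) \<partial>lborel) \<partial>lborel)"
    by (rule lborel_pair.Fubini'[symmetric]) measurable
  also have "\<dots> = (\<integral>\<^sup>+y. (\<integral>\<^sup>+x. g (x - u * y) * f x \<partial>lborel) \<partial>lborel)"
  proof (rule nn_integral_cong)
    fix y :: complex
    show "(\<integral>\<^sup>+x. g x * f (x + u * y) \<partial>lborel) = (\<integral>\<^sup>+x. g (x - u * y) * f x \<partial>lborel)"
      by (subst nn_integral_lborel_shift[of "\<lambda>x. g x * f (x + u * y)" "- (u * y)", symmetric])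
        (simp_all add: algebra_simps)
  qed
  also have "\<dots> = (\<integral>\<^sup>+x. (\<integral>\<^sup>+y. g (x - u * y) * f x \<partial>lborel) \<partial>lborel)"
    by (rule lborel_pair.Fubini') measurable
  also have "\<dots> = (\<integral>\<^sup>+x. V * f x \<partial>lborel)"
    by (intro nn_integral_cong) (subst nn_integral_multc, measurable, simp add: inner)
  also have "\<dots> = V * (\<integral>\<^sup>+x. f x \<partial>lborel)"
    by (rule nn_integral_cmult) measurable
  finally show ?thesis
    using ennreal_mult_cancel_left[of V] by (auto simp: V)
qed

text \<open>Normalised arc length, carried as a Borel measure on the whole plane; lying on the unit
  circle becomes the almost sure statement \<open>AE_circle_norm\<close>.\<close>

definition circle_measure :: "complex measure" where
  "circle_measure = distr (restrict_space lborel {0..1}) borel (circlepath 0 1)"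

lemma measurable_circlepath [measurable]: "circlepath z r \<in> borel_measurable borel"
  unfolding circlepath part_circlepath_def by (intro borel_measurable_continuous_onI continuous_intros)

lemma measurable_circlepath_restrict [measurable]:
  "circlepath z r \<in> restrict_space lborel {0..1} \<rightarrow>\<^sub>M borel"
  by (intro measurable_restrict_space1) simp

lemma sets_circle_measure [measurable_cong, simp]: "sets circle_measure = sets borel"
  and space_circle_measure [simp]: "space circle_measure = UNIV"
  by (simp_all add: circle_measure_def)

interpretation circle: prob_space circle_measure
  unfolding circle_measure_def
  by (intro prob_space.prob_space_distr prob_space_restrict_space) auto

lemma measure_circle_UNIV [simp]: "measure circle_measure UNIV = 1"
  using circle.prob_space by simp

interpretation circle_pair: pair_sigma_finite circle_measure circle_measure ..

lemma AE_circle_norm: "AE u in circle_measure. norm u = 1"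
  unfolding circle_measure_def
  by (subst AE_distr_iff) (measurable, simp add: circlepath)

text \<open>Two parameters with the same image differ by an integer, so the preimage of a point is
  countable. This discards the zeros of the arguments of logarithms.\<close>

lemma AE_circle_neq: "AE u in circle_measure. u \<noteq> x"
proof -
  have "countable {t. circlepath 0 1 t = x}"
  proof (cases "\<exists>t. circlepath 0 1 t = x")
    case True
    then obtain t0 where t0: "circlepath 0 1 t0 = x" by auto
    have "{t. circlepath 0 1 t = x} \<subseteq> range (\<lambda>n::int. t0 + of_int n)"
    proof
      fix t assume "t \<in> {t. circlepath 0 1 t = x}"
      then have "exp (2 * of_real pi * \<i> * of_real t) = exp (2 * of_real pi * \<i> * of_real t0)"
        using t0 by (simp add: circlepath)
      then obtain n :: int where
        "2 * of_real pi * \<i> * of_real t = 2 * of_real pi * \<i> * of_real t0 + of_int (2 * n) * (of_real pi * \<i>)"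
        by (auto simp: exp_eq)
      then have "2 * of_real pi * \<i> * of_real t = 2 * of_real pi * \<i> * (of_real (t0 + of_int n) :: complex)"
        by (simp add: algebra_simps)
      then have "t = t0 + of_int n" by (simp only: mult_cancel_left of_real_eq_iff) simp
      then show "t \<in> range (\<lambda>n::int. t0 + of_int n)" by auto
    qed
    then show ?thesis by (rule countable_subset) simp
  qed (auto simp: countable_empty)
  then have "{t. circlepath 0 1 t = x} \<in> null_sets lborel"
    by (rule countable_imp_null_set_lborel)
  then have "AE t in lborel. circlepath 0 1 t \<noteq> x"
    using AE_not_in by fastforce
  then show ?thesis
    unfolding circle_measure_def
    by (subst AE_distr_iff) (auto simp: AE_restrict_space_iff)
qed

text \<open>Cauchy's integral formula at the centre: along the path the factor \<open>u\<close> in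
  the derivative cancels the denominator.\<close>

lemma circle_mean_value:
  fixes f :: "complex \<Rightarrow> complex"
  assumes cont: "continuous_on (cball 0 1) f" and hol: "f holomorphic_on ball 0 1"
    and meas: "f \<in> borel_measurable borel"
  shows "integrable circle_measure f" "integral\<^sup>L circle_measure f = f 0"
proof -
  have "((\<lambda>u. f u / (u - 0)) has_contour_integral (2 * of_real pi * \<i> * f 0)) (circlepath 0 1)"
    by (rule Cauchy_integral_circlepath[OF cont hol]) simp
  then have "((\<lambda>t. f (circlepath 0 1 t) * (2 * of_real pi * \<i>)) has_integral (2 * of_real pi * \<i> * f 0)) {0..1}"
    unfolding has_contour_integral_def
    by (rule has_integral_eq[rotated])
      (simp add: vector_derivative_circlepath01, simp add: circlepath)
  from has_integral_mult_left[OF this, of "1 / (2 * of_real pi * \<i>)"]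
  have int: "((\<lambda>t. f (circlepath 0 1 t)) has_integral f 0) {0..1}"
    by simp
  have "continuous_on {0..1} (\<lambda>t. f (circlepath 0 1 t))"
    by (rule continuous_on_compose2[OF cont])
      (auto simp: circlepath norm_mult intro!: continuous_intros)
  then have si: "set_integrable lborel {0..1} (\<lambda>t. f (circlepath 0 1 t))"
    by (rule borel_integrable_atLeastAtMost')
  then have "integrable (restrict_space lborel {0..1}) (\<lambda>t. f (circlepath 0 1 t))"
    by (subst integrable_restrict_space) (auto simp: set_integrable_def)
  then show "integrable circle_measure f"
    unfolding circle_measure_def using meas by (subst integrable_distr_eq) auto
  have "integral\<^sup>L circle_measure f = (LINT t|restrict_space lborel {0..1}. f (circlepath 0 1 t))"
    unfolding circle_measure_def using meas by (subst integral_distr) auto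
  also have "\<dots> = (LINT t:{0..1}|lborel. f (circlepath 0 1 t))"
    by (subst integral_restrict_space) (auto simp: set_lebesgue_integral_def)
  also have "\<dots> = integral {0..1} (\<lambda>t. f (circlepath 0 1 t))"
    using si by (rule set_borel_integral_eq_integral)
  also have "\<dots> = f 0"
    using int by (rule integral_unique)
  finally show "integral\<^sup>L circle_measure f = f 0" .
qed

section \<open>Jensen's formula\<close>

text \<open>On the closed disc \<open>1 - q * w\<close> avoids the nonpositive reals, so the
  principal branch \<open>Ln (1 - q * w)\<close> has the mean value property, and it vanishes at
  0.\<close>

lemma circle_ln_norm_one_minus_less:
  assumes q: "norm q < 1"
  shows "integrable circle_measure (\<lambda>u. ln (norm (1 - q * u)))"
    and "(\<integral>u. ln (norm (1 - q * u)) \<partial>circle_measure) = 0"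
proof -
  \<comment> \<open>The cut-off supplies Borel measurability on the whole plane.\<close>
  define f where "f w = indicat_real (cball 0 1) w *\<^sub>R Ln (1 - q * w)" for w
  have nz: "1 - q * w \<notin> \<real>\<^sub>\<le>\<^sub>0" if "norm w \<le> 1" for w
  proof
    assume "1 - q * w \<in> \<real>\<^sub>\<le>\<^sub>0"
    then have "Re (q * w) \<ge> 1" by (simp add: complex_nonpos_Reals_iff)
    moreover have "Re (q * w) \<le> norm (q * w)" by (rule complex_Re_le_cmod)
    moreover have "norm (q * w) \<le> norm q * 1"
      unfolding norm_mult using that by (intro mult_left_mono) auto
    ultimately show False using q by simp
  qed
  have contL: "continuous_on (cball 0 1) (\<lambda>w. Ln (1 - q * w))"
    using nz by (intro continuous_intros) auto
  have cont: "continuous_on (cball 0 1) f"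
    by (rule continuous_on_cong[THEN iffD1, OF refl _ contL]) (simp add: f_def)
  have "(\<lambda>w. Ln (1 - q * w)) holomorphic_on ball 0 1"
    using nz by (intro holomorphic_intros) auto
  then have hol: "f holomorphic_on ball 0 1"
    by (rule holomorphic_transform) (simp add: f_def)
  have meas: "f \<in> borel_measurable borel"
    unfolding f_def using contL by (intro borel_measurable_continuous_on_indicator) auto
  note mv = circle_mean_value[OF cont hol meas]
  have eq: "AE u in circle_measure. ln (norm (1 - q * u)) = Re (f u)"
    using AE_circle_norm
  proof eventually_elim
    case (elim u)
    then have "1 - q * u \<noteq> 0" using nz[of u] by auto
    then show ?case using elim by (simp add: f_def)
  qed
  have "integrable circle_measure (\<lambda>u. Re (f u))" using mv(1) by simp
  then show "integrable circle_measure (\<lambda>u. ln (norm (1 - q * u)))"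
    by (rule integrable_cong_AE[THEN iffD2, rotated -1])
      (use eq mv(1) in auto)
  have "(\<integral>u. ln (norm (1 - q * u)) \<partial>circle_measure) = (\<integral>u. Re (f u) \<partial>circle_measure)"
    by (rule integral_cong_AE) (use eq mv(1) in auto)
  also have "\<dots> = Re (f 0)" using mv by simp
  finally show "(\<integral>u. ln (norm (1 - q * u)) \<partial>circle_measure) = 0"
    by (simp add: f_def)
qed

lemma AE_circle_one_minus_neq: "AE u in circle_measure. 1 - q * u \<noteq> 0"
  using AE_circle_neq[of "1 / q"]
proof eventually_elim
  case (elim u)
  show ?case
  proof
    assume "1 - q * u = 0"
    then have "q * u = 1" by simp
    moreover from this have "q \<noteq> 0" by auto
    ultimately have "u = 1 / q" by (simp add: field_simps)
    with elim show False by simp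
  qed
qed

lemma circle_ln_norm_one_minus:
  assumes q: "norm q \<le> 1"
  shows "integrable circle_measure (\<lambda>u. ln (norm (1 - q * u)))"
    and "(\<integral>u. ln (norm (1 - q * u)) \<partial>circle_measure) = 0"
proof -
  \<comment> \<open>If \<open>|q| = 1\<close>, the integrand is singular: approximate \<open>q\<close> by \<open>s m * q\<close>. Fatou gives integrability, and
    \<open>|1 - q u| \<le> 2 |1 - s m * q u|\<close> the domination.\<close>
  define s :: "nat \<Rightarrow> real" where "s m = real (Suc m) / real (Suc (Suc m))" for m
  have s: "0 < s m" "s m < 1" for m by (simp_all add: s_def field_simps)
  have slim: "s \<longlonglongrightarrow> 1"
    unfolding s_def by (rule LIMSEQ_Suc[OF LIMSEQ_n_over_Suc_n])
  \<comment> \<open>Since \<open>norm (1 - c * u) \<le> 2\<close>, the summand \<open>ln 2\<close>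
    makes both functions nonnegative almost everywhere, as Fatou's lemma requires.\<close>
  define F where "F u = ln 2 - ln (norm (1 - q * u))" for u
  define G where "G m u = ln 2 - ln (norm (1 - of_real (s m) * q * u))" for m u
  have [measurable]: "F \<in> borel_measurable borel" "G m \<in> borel_measurable borel" for m
    unfolding F_def G_def by measurable
  have qs: "norm (of_real (s m) * q) < 1" for m
  proof -
    have "norm (of_real (s m) * q) \<le> s m * 1"
      unfolding norm_mult using s[of m] q by (intro mult_mono) auto
    then show ?thesis using s[of m] by simp
  qed
  have intG: "integrable circle_measure (G m)" "integral\<^sup>L circle_measure (G m) = ln 2" for m
    using circle_ln_norm_one_minus_less[OF qs[of m]] unfolding G_def by simp_all
  have le2: "norm (1 - c * u) \<le> 2" if "norm u = 1" "norm c \<le> 1" for c u :: complex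
  proof -
    have "norm (1 - c * u) \<le> norm (1::complex) + norm (c * u)" by (rule norm_triangle_ineq4)
    then show ?thesis using that by (simp add: norm_mult)
  qed
  have neq: "AE u in circle_measure. norm u = 1 \<and> 1 - q * u \<noteq> 0"
    using AE_circle_norm AE_circle_one_minus_neq[of q] by eventually_elim simp
  have props: "0 \<le> F u" "0 \<le> G m u" "G m u \<le> F u + ln 2" "(\<lambda>m. G m u) \<longlonglongrightarrow> F u"
    if u: "norm u = 1" "1 - q * u \<noteq> 0" for u m
  proof -
    have nz: "1 - of_real (s m) * q * u \<noteq> 0" for m
    proof
      assume "1 - of_real (s m) * q * u = 0"
      then have "norm (of_real (s m) * q * u) = 1" by simp
      then show False using qs[of m] u by (simp add: norm_mult)
    qed
    show "0 \<le> F u" unfolding F_def using le2[OF u(1) q] u by simp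
    show "0 \<le> G m u" unfolding G_def
      using le2[OF u(1), of "of_real (s m) * q"] qs[of m] nz[of m] by simp
    \<comment> \<open>Passing from \<open>s m * q\<close> to \<open>q\<close> costs at most
      \<open>1 - s m\<close>, which is itself at most \<open>norm (1 - s m * q * u)\<close>; hence
      the factor 2.\<close>
    have "norm (1 - q * u) = norm ((1 - of_real (s m) * q * u) - (1 - of_real (s m)) * (q * u))"
      by (simp add: algebra_simps)
    also have "\<dots> \<le> norm (1 - of_real (s m) * q * u) + norm ((1 - of_real (s m)) * (q * u))"
      by (rule norm_triangle_ineq4)
    also have "norm ((1 - of_real (s m)) * (q * u)) \<le> (1 - s m) * 1"
    proof -
      have "norm (1 - of_real (s m) :: complex) = 1 - s m"
        using s[of m] by (metis abs_of_nonneg diff_ge_0_iff_ge less_imp_le norm_of_real of_real_1 of_real_diff)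
      then show ?thesis
        unfolding norm_mult using s[of m] q u by (simp add: mult_left_le)
    qed
    also have "(1 - s m) * 1 \<le> norm (1 - of_real (s m) * q * u)"
    proof -
      have "norm (of_real (s m) * q * u) \<le> s m"
        using s[of m] q u by (simp add: norm_mult mult_left_le)
      moreover have "norm (1::complex) - norm (of_real (s m) * q * u) \<le> norm (1 - of_real (s m) * q * u)"
        by (rule norm_triangle_ineq2)
      ultimately show ?thesis by simp
    qed
    finally have "norm (1 - q * u) \<le> 2 * norm (1 - of_real (s m) * q * u)" by simp
    then have "ln (norm (1 - q * u)) \<le> ln (2 * norm (1 - of_real (s m) * q * u))"
      using u nz[of m] by (subst ln_le_cancel_iff) auto
    then show "G m u \<le> F u + ln 2"
      unfolding F_def G_def using nz[of m] by (simp add: ln_mult)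
    show "(\<lambda>m. G m u) \<longlonglongrightarrow> F u"
      unfolding F_def G_def using slim u(2)
      by (auto intro!: tendsto_eq_intros)
  qed
  have "(\<integral>\<^sup>+u. ennreal (F u) \<partial>circle_measure) = (\<integral>\<^sup>+u. liminf (\<lambda>m. ennreal (G m u)) \<partial>circle_measure)"
    using neq
    by (intro nn_integral_cong_AE, eventually_elim)
      (metis props(4) tendsto_ennrealI lim_imp_Liminf sequentially_bot)
  also have "\<dots> \<le> liminf (\<lambda>m. \<integral>\<^sup>+u. ennreal (G m u) \<partial>circle_measure)"
    by (rule nn_integral_liminf) simp
  also have "\<dots> = ennreal (ln 2)"
  proof -
    have "(\<integral>\<^sup>+u. ennreal (G m u) \<partial>circle_measure) = ennreal (ln 2)" for m
      using neq props(2)[of _ m] intG[of m]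
      by (subst nn_integral_eq_integral) (auto elim: eventually_mono)
    then show ?thesis by (simp add: Liminf_const)
  qed
  finally have fin: "(\<integral>\<^sup>+u. ennreal (F u) \<partial>circle_measure) < \<infinity>"
    by (simp add: order_le_less_trans)
  have intF: "integrable circle_measure F"
    using neq props(1) fin by (intro integrableI_nonneg) (auto elim: eventually_mono)
  have "(\<lambda>m. integral\<^sup>L circle_measure (G m)) \<longlonglongrightarrow> integral\<^sup>L circle_measure F"
  proof (rule integral_dominated_convergence)
    show "integrable circle_measure (\<lambda>u. F u + ln 2)" using intF by simp
    show "AE u in circle_measure. (\<lambda>m. G m u) \<longlonglongrightarrow> F u"
      using neq by eventually_elim (auto intro: props)
    show "AE u in circle_measure. norm (G m u) \<le> F u + ln 2" for m
      using neq by eventually_elim (use props(2,3) in auto)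
  qed auto
  then have F: "integral\<^sup>L circle_measure F = ln 2"
    by (simp add: intG LIMSEQ_const_iff)
  have eq: "ln (norm (1 - q * u)) = ln 2 - F u" for u by (simp add: F_def)
  show "integrable circle_measure (\<lambda>u. ln (norm (1 - q * u)))"
    unfolding eq using intF by simp
  show "(\<integral>u. ln (norm (1 - q * u)) \<partial>circle_measure) = 0"
    unfolding eq using intF F by (simp)
qed

text \<open>Factor out whichever of \<open>z\<close> and \<open>c\<close> has the larger modulus.
  What remains is \<open>norm (1 - q * u)\<close> with \<open>norm q \<le> 1\<close>, whose
  logarithm has mean 0.\<close>

lemma circle_ln_norm_diff:
  fixes z c :: complex
  assumes z: "z \<noteq> 0"
  shows "integrable circle_measure (\<lambda>u. ln (norm (u * z - c)))"
    and "(\<integral>u. ln (norm (u * z - c)) \<partial>circle_measure) = ln (max (norm z) (norm c))"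
proof -
  obtain q b where q: "norm q \<le> 1" and b: "b = max (norm z) (norm c)"
    and eq: "\<And>u. norm u = 1 \<Longrightarrow> norm (u * z - c) = b * norm (1 - q * u)"
  proof (cases "norm c \<le> norm z")
    case True
    \<comment> \<open>As \<open>1 / u = cnj u\<close> on the circle, \<open>1 - c / (z * u)\<close>
      is the conjugate of \<open>1 - cnj (c / z) * u\<close>.\<close>
    have "norm (u * z - c) = norm z * norm (1 - cnj (c / z) * u)" if "norm u = 1" for u
    proof -
      have "cnj (1 - cnj (c / z) * u) * u = u - c / z * (u * cnj u)"
        by (simp add: algebra_simps)
      also have "u * cnj u = 1" using that by (simp add: complex_norm_square[symmetric])
      finally have "u * z - c = z * (cnj (1 - cnj (c / z) * u) * u)"
        using z by (simp add: field_simps)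
      then show ?thesis using that by (simp only: norm_mult complex_mod_cnj mult_1_right)
    qed
    then show ?thesis
      using True z by (intro that[of "cnj (c / z)" "norm z"]) (simp_all add: norm_divide)
  next
    case False
    then have "c \<noteq> 0" by auto
    have "norm (u * z - c) = norm c * norm (1 - z / c * u)" for u
    proof -
      have "u * z - c = - c * (1 - z / c * u)" using \<open>c \<noteq> 0\<close> by (simp add: field_simps)
      then show ?thesis by (simp only: norm_mult norm_minus_cancel)
    qed
    then show ?thesis
      using False \<open>c \<noteq> 0\<close> by (intro that[of "z / c" "norm c"]) (simp_all add: norm_divide divide_le_eq)
  qed
  have b0: "b > 0" using z by (simp add: b less_max_iff_disj)
  have AE: "AE u in circle_measure. ln (norm (u * z - c)) = ln b + ln (norm (1 - q * u))"
    using AE_circle_norm AE_circle_one_minus_neq[of q]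
  proof eventually_elim
    case (elim u)
    then show ?case using elim b0 by (simp add: eq ln_mult)
  qed
  note I = circle_ln_norm_one_minus[OF q]
  have I2: "integrable circle_measure (\<lambda>u. ln b + ln (norm (1 - q * u)))"
    using I(1) by simp
  then show "integrable circle_measure (\<lambda>u. ln (norm (u * z - c)))"
    by (rule integrable_cong_AE[THEN iffD2, rotated -1]) (use AE in auto)
  have "(\<integral>u. ln (norm (u * z - c)) \<partial>circle_measure)
      = (\<integral>u. ln b + ln (norm (1 - q * u)) \<partial>circle_measure)"
    by (rule integral_cong_AE) (use AE in auto)
  also have "\<dots> = ln b" using I by (simp)
  finally show "(\<integral>u. ln (norm (u * z - c)) \<partial>circle_measure) = ln (max (norm z) (norm c))"
    by (simp add: b)
qed

text \<open>This is \<open>|x| = \<integral> (ln (max \<rho> |x|) - ln \<rho>) d\<rho>\<close> with \<open>\<rho> = exp (- s)\<close>.\<close>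

lemma nn_integral_log_layer:
  fixes x :: real
  assumes "x \<ge> 0"
  shows "(\<integral>\<^sup>+s. ennreal (exp (- s) * (ln (max (exp (- s)) x) + s)) \<partial>lborel) = ennreal x"
proof (cases "x = 0")
  case False
  with assms have x: "x > 0" by simp
  \<comment> \<open>An antiderivative of \<open>exp (- s) * (ln x + s)\<close>, to which the
    integrand reduces for \<open>s \<ge> - ln x\<close>; below that it is 0. Note
    \<open>F (- ln x) = - x\<close>.\<close>
  define F where "F s = - exp (- s) * (ln x + s + 1)" for s
  have eq: "ennreal (exp (- s) * (ln (max (exp (- s)) x) + s))
      = ennreal (exp (- s) * (ln x + s)) * indicator {- ln x..} s" for s
  proof (cases "s \<ge> - ln x")
    case True
    then have "exp (- s) \<le> exp (ln x)" by (subst exp_le_cancel_iff) simp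
    then have "exp (- s) \<le> x" using x by simp
    then show ?thesis using True by (simp add: max_def)
  next
    case False
    then have "exp (ln x) < exp (- s)" by (subst exp_less_cancel_iff) simp
    then have "x < exp (- s)" using x by simp
    then show ?thesis using False by (simp add: max_def)
  qed
  have "(\<integral>\<^sup>+s. ennreal (exp (- s) * (ln x + s)) * indicator {- ln x..} s \<partial>lborel) = ennreal (0 - F (- ln x))"
  proof (rule nn_integral_FTC_atLeast)
    show "DERIV F s :> exp (- s) * (ln x + s)" for s
      unfolding F_def by (auto intro!: derivative_eq_intros simp: algebra_simps)
    show "(F \<longlongrightarrow> 0) at_top"
      unfolding F_def by real_asymp
  qed auto
  then show ?thesis unfolding eq using x by (simp add: F_def)
qed simp

text \<open>Jensen's formula for a factored polynomial: for almost every \<open>u\<close> no factor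
  vanishes and the logarithm splits into a sum.\<close>

lemma circle_ln_norm_prod:
  fixes z l :: complex and r :: "'i \<Rightarrow> complex"
  assumes z: "z \<noteq> 0" and l: "l \<noteq> 0" and A: "finite A"
  shows "integrable circle_measure (\<lambda>u. ln (norm (l * (\<Prod>i\<in>A. u * z - r i))))"
    and "(\<integral>u. ln (norm (l * (\<Prod>i\<in>A. u * z - r i))) \<partial>circle_measure)
      = ln (norm l) + (\<Sum>i\<in>A. ln (max (norm z) (norm (r i))))"
proof -
  have "AE u in circle_measure. \<forall>i\<in>A. u \<noteq> r i / z"
    using A AE_circle_neq by (intro AE_finite_allI)
  then have AE: "AE u in circle_measure. ln (norm (l * (\<Prod>i\<in>A. u * z - r i)))
      = ln (norm l) + (\<Sum>i\<in>A. ln (norm (u * z - r i)))"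
  proof eventually_elim
    case (elim u)
    have nz: "u * z - r i \<noteq> 0" if "i \<in> A" for i
      using elim z that by (auto simp: field_simps)
    have "(\<Prod>i\<in>A. norm (u * z - r i)) \<noteq> 0" using nz A by simp
    then show ?case
      using l nz A by (simp add: norm_mult ln_mult ln_prod prod_norm[symmetric])
  qed
  have I: "integrable circle_measure (\<lambda>u. ln (norm l) + (\<Sum>i\<in>A. ln (norm (u * z - r i))))"
    using circle_ln_norm_diff(1)[OF z] by auto
  then show "integrable circle_measure (\<lambda>u. ln (norm (l * (\<Prod>i\<in>A. u * z - r i))))"
    by (rule integrable_cong_AE[THEN iffD2, rotated -1]) (use AE in auto)
  have "(\<integral>u. ln (norm (l * (\<Prod>i\<in>A. u * z - r i))) \<partial>circle_measure)
      = (\<integral>u. ln (norm l) + (\<Sum>i\<in>A. ln (norm (u * z - r i))) \<partial>circle_measure)"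
    by (rule integral_cong_AE) (use AE in auto)
  also have "\<dots> = ln (norm l) + (\<Sum>i\<in>A. ln (max (norm z) (norm (r i))))"
    using circle_ln_norm_diff[OF z] by simp
  finally show "(\<integral>u. ln (norm (l * (\<Prod>i\<in>A. u * z - r i))) \<partial>circle_measure)
      = ln (norm l) + (\<Sum>i\<in>A. ln (max (norm z) (norm (r i))))" .
qed

lemma integrable_ln_max:
  fixes g :: "complex \<Rightarrow> complex"
  assumes [measurable]: "g \<in> borel_measurable borel"
    and C: "\<And>u. norm u = 1 \<Longrightarrow> norm (g u) \<le> C" and \<rho>: "\<rho> > 0"
  shows "integrable circle_measure (\<lambda>u. ln (max \<rho> (norm (g u))))"
proof (rule circle.integrable_const_bound[where B="max \<bar>ln \<rho>\<bar> \<bar>ln (max \<rho> C)\<bar>"])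
  show "AE u in circle_measure. norm (ln (max \<rho> (norm (g u)))) \<le> max \<bar>ln \<rho>\<bar> \<bar>ln (max \<rho> C)\<bar>"
    using AE_circle_norm
  proof eventually_elim
    case (elim u)
    have "ln \<rho> \<le> ln (max \<rho> (norm (g u)))" "ln (max \<rho> (norm (g u))) \<le> ln (max \<rho> C)"
      using C[OF elim] \<rho> by (subst ln_le_cancel_iff; auto simp: less_max_iff_disj)+
    then show ?case by (auto simp: abs_le_iff le_max_iff_disj)
  qed
qed measurable

text \<open>For fixed \<open>u\<close> the mean over \<open>v\<close> is given by
  \<open>circle_ln_norm_diff\<close>; the work lies in justifying Fubini for an unbounded
  logarithm.\<close>

lemma circle_ln_norm_swap:
  fixes g :: "complex \<Rightarrow> complex"
  assumes g [measurable]: "g \<in> borel_measurable borel"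
    and C: "\<And>u. norm u = 1 \<Longrightarrow> norm (g u) \<le> C" and \<rho>: "\<rho> > 0"
  shows "integrable circle_measure (\<lambda>v. \<integral>u. ln (norm (v * of_real \<rho> - g u)) \<partial>circle_measure)"
    and "(\<integral>v. (\<integral>u. ln (norm (v * of_real \<rho> - g u)) \<partial>circle_measure) \<partial>circle_measure)
      = (\<integral>u. ln (max \<rho> (norm (g u))) \<partial>circle_measure)"
proof -
  \<comment> \<open>\<open>K\<close> bounds the argument of the logarithm on the circles, so
    \<open>h\<close> is nonnegative there and its iterated integral controls its absolute value.
    Having \<open>K\<close> at least 1 covers zeros of the argument, where
    \<open>ln 0 = 0\<close>.\<close>
  define K where "K = max 1 (\<rho> + C)"
  define h where "h u v = ln K - ln (norm (v * of_real \<rho> - g u))" for u v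
  have [measurable]: "(\<lambda>(u, v). h u v) \<in> borel_measurable (circle_measure \<Otimes>\<^sub>M circle_measure)"
    unfolding h_def by measurable
  have h0: "0 \<le> h u v" if "norm u = 1" "norm v = 1" for u v
  proof -
    have "norm (v * of_real \<rho> - g u) \<le> norm (v * of_real \<rho>) + norm (g u)"
      by (rule norm_triangle_ineq4)
    also have "\<dots> \<le> K" using C[OF that(1)] that \<rho> by (simp add: K_def norm_mult)
    finally have "norm (v * of_real \<rho> - g u) \<le> K" .
    then show ?thesis
      unfolding h_def by (cases "v * of_real \<rho> - g u = 0") (auto simp: K_def)
  qed
  have \<rho>0: "of_real \<rho> \<noteq> (0::complex)" using \<rho> by simp
  have inth: "integrable circle_measure (h u)"
      "integral\<^sup>L circle_measure (h u) = ln K - ln (max \<rho> (norm (g u)))" for u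
    using circle_ln_norm_diff[OF \<rho>0, of "g u"] \<rho> unfolding h_def by simp_all
  have "integrable circle_measure (\<lambda>u. \<integral>v. norm (h u v) \<partial>circle_measure)"
  proof (rule integrable_cong_AE[THEN iffD2, rotated -1])
    show "integrable circle_measure (\<lambda>u. ln K - ln (max \<rho> (norm (g u))))"
      using integrable_ln_max[OF g C \<rho>] by simp
    show "AE u in circle_measure. (\<integral>v. norm (h u v) \<partial>circle_measure) = ln K - ln (max \<rho> (norm (g u)))"
      using AE_circle_norm
    proof eventually_elim
      case (elim u)
      have "(\<integral>v. norm (h u v) \<partial>circle_measure) = (\<integral>v. h u v \<partial>circle_measure)"
        using AE_circle_norm h0[OF elim]
        by (intro integral_cong_AE) (auto elim: eventually_mono simp: h_def)
      then show ?case using inth by simp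
    qed
  qed measurable
  then have int: "integrable (circle_measure \<Otimes>\<^sub>M circle_measure) (\<lambda>(u, v). h u v)"
    by (intro circle_pair.Fubini_integrable) (auto simp: inth)
  have eq: "(\<integral>u. ln (norm (v * of_real \<rho> - g u)) \<partial>circle_measure) = ln K - (\<integral>u. h u v \<partial>circle_measure)"
    if "integrable circle_measure (\<lambda>u. h u v)" for v
  proof -
    have "(\<integral>u. ln (norm (v * of_real \<rho> - g u)) \<partial>circle_measure) = (\<integral>u. ln K - h u v \<partial>circle_measure)"
      by (simp add: h_def)
    then show ?thesis using that by simp
  qed
  \<comment> \<open>Fubini yields integrability in \<open>u\<close> only for almost every
    \<open>v\<close>.\<close>
  have AE: "AE v in circle_measure. (\<integral>u. ln (norm (v * of_real \<rho> - g u)) \<partial>circle_measure)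
      = ln K - (\<integral>u. h u v \<partial>circle_measure)"
    using circle_pair.AE_integrable_snd[OF int] by eventually_elim (rule eq)
  have I: "integrable circle_measure (\<lambda>v. ln K - (\<integral>u. h u v \<partial>circle_measure))"
    using circle_pair.integrable_snd[OF int] by simp
  then show "integrable circle_measure (\<lambda>v. \<integral>u. ln (norm (v * of_real \<rho> - g u)) \<partial>circle_measure)"
    by (rule integrable_cong_AE[THEN iffD2, rotated -1]) (use AE in auto)
  have "(\<integral>v. (\<integral>u. ln (norm (v * of_real \<rho> - g u)) \<partial>circle_measure) \<partial>circle_measure)
      = (\<integral>v. ln K - (\<integral>u. h u v \<partial>circle_measure) \<partial>circle_measure)"
    by (rule integral_cong_AE) (use AE in auto)
  also have "\<dots> = ln K - (\<integral>v. (\<integral>u. h u v \<partial>circle_measure) \<partial>circle_measure)"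
    using circle_pair.integrable_snd[OF int] by simp
  also have "(\<integral>v. (\<integral>u. h u v \<partial>circle_measure) \<partial>circle_measure)
      = (\<integral>u. (\<integral>v. h u v \<partial>circle_measure) \<partial>circle_measure)"
    by (rule circle_pair.Fubini_integral[OF int])
  also have "\<dots> = ln K - (\<integral>u. ln (max \<rho> (norm (g u))) \<partial>circle_measure)"
    using integrable_ln_max[OF g C \<rho>] by (simp add: inth)
  finally show "(\<integral>v. (\<integral>u. ln (norm (v * of_real \<rho> - g u)) \<partial>circle_measure) \<partial>circle_measure)
      = (\<integral>u. ln (max \<rho> (norm (g u))) \<partial>circle_measure)" by simp
qed

section \<open>The level polynomials\<close>

definition config_poly :: "nat \<Rightarrow> (nat \<Rightarrow> complex) \<Rightarrow> complex poly" where
  "config_poly n a = (\<Prod>k = 1..n. [:- a k, 1:])"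

text \<open>The roots of \<open>level_poly n a \<zeta>\<close> in the open unit disc are the points where \<open>g = \<zeta>\<close>.\<close>

definition level_poly :: "nat \<Rightarrow> (nat \<Rightarrow> complex) \<Rightarrow> complex \<Rightarrow> complex poly" where
  "level_poly n a \<zeta> = smult \<zeta> (config_poly n a) - pCons 0 (pderiv (config_poly n a))"

lemma poly_config_poly: "poly (config_poly n a) w = (\<Prod>k = 1..n. w - a k)"
  by (simp add: config_poly_def poly_prod)

lemma degree_config_poly: "degree (config_poly n a) = n"
  by (simp add: config_poly_def degree_prod_sum_eq)

lemma coeff_config_poly: "coeff (config_poly n a) n = 1"
proof -
  have "lead_coeff (config_poly n a) = 1" by (simp add: config_poly_def lead_coeff_prod)
  then show ?thesis by (simp add: degree_config_poly)
qed

text \<open>The logarithmic derivative of a product, cleared of denominators.\<close>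

lemma poly_level_poly:
  assumes "\<And>k. k \<in> {1..n} \<Longrightarrow> w \<noteq> a k"
  shows "poly (level_poly n a \<zeta>) w = (\<zeta> - (\<Sum>k = 1..n. w / (w - a k))) * poly (config_poly n a) w"
proof -
  have "poly (pderiv (config_poly n a)) w = (\<Sum>k = 1..n. \<Prod>j\<in>{1..n} - {k}. w - a j)"
    by (simp add: config_poly_def pderiv_prod poly_sum poly_prod pderiv_pCons)
  also have "\<dots> = (\<Sum>k = 1..n. poly (config_poly n a) w / (w - a k))"
  proof (rule sum.cong)
    fix k assume k: "k \<in> {1..n}"
    have "poly (config_poly n a) w = (w - a k) * (\<Prod>j\<in>{1..n} - {k}. w - a j)"
      unfolding poly_config_poly using k by (intro prod.remove) auto
    then show "(\<Prod>j\<in>{1..n} - {k}. w - a j) = poly (config_poly n a) w / (w - a k)"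
      using assms[OF k] by simp
  qed simp
  finally show ?thesis
    by (simp add: level_poly_def sum_distrib_left sum_distrib_right algebra_simps)
qed

text \<open>Vieta: the coefficient at \<open>n\<close> is \<open>\<zeta> - of_nat n\<close>, nonzero
  by assumption, and the constant term has modulus \<open>norm \<zeta>\<close> because all
  \<open>a k\<close> are unimodular.\<close>

lemma level_poly_decompose:
  assumes n: "n \<ge> 1" and a: "unit_config n a" and \<zeta>: "\<zeta> \<noteq> of_nat n"
  obtains r where "\<And>w. poly (level_poly n a \<zeta>) w = (\<zeta> - of_nat n) * (\<Prod>i<n. w - r i)"
    and "(\<Prod>i<n. norm (r i)) = norm \<zeta> / norm (\<zeta> - of_nat n)"
proof -
  let ?p = "config_poly n a" and ?q = "level_poly n a \<zeta>"
  obtain m where m: "n = Suc m" using n by (cases n) auto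
  have cn: "coeff ?q n = \<zeta> - of_nat n"
    using coeff_config_poly[of n a] by (simp add: level_poly_def m coeff_pderiv del: of_nat_Suc)
  have "degree ?q \<le> n"
    unfolding level_poly_def
  proof (rule degree_diff_le)
    show "degree (smult \<zeta> ?p) \<le> n"
      using degree_smult_le[of \<zeta> ?p] by (simp add: degree_config_poly)
    show "degree (pCons 0 (pderiv ?p)) \<le> n"
      using degree_pCons_le[of 0 "pderiv ?p"] by (simp add: degree_pderiv degree_config_poly m)
  qed
  then have deg: "degree ?q = n"
    using \<zeta> cn le_degree[of ?q n] by auto
  obtain r where r: "smult (lead_coeff ?q) (\<Prod>i<degree ?q. [:- r i, 1:]) = ?q"
    by (rule complex_poly_decompose')
  have eq: "poly ?q w = (\<zeta> - of_nat n) * (\<Prod>i<n. w - r i)" for w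
    by (subst r[symmetric]) (simp add: deg cn poly_prod)
  have "norm (poly ?q 0) = norm \<zeta>"
  proof -
    have "norm (poly ?p 0) = 1"
      using a by (simp add: poly_config_poly prod_norm[symmetric] unit_config_def)
    then show ?thesis by (simp add: level_poly_def norm_mult)
  qed
  moreover have "norm (poly ?q 0) = norm (\<zeta> - of_nat n) * (\<Prod>i<n. norm (r i))"
    unfolding eq by (simp add: norm_mult prod_norm[symmetric])
  ultimately have "(\<Prod>i<n. norm (r i)) = norm \<zeta> / norm (\<zeta> - of_nat n)"
    using \<zeta> by (simp add: field_simps)
  with eq show ?thesis by (rule that)
qed

section \<open>The equispaced configuration and its level polynomials\<close>

lemma unit_config_equispaced: "unit_config n (equispaced n)"
  by (simp add: unit_config_def equispaced_def)

text \<open>Both sides have degree at most \<open>n\<close> and coefficient 1 at \<open>n\<close>,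
  so agreement at the \<open>n\<close> distinct roots of unity suffices.\<close>

lemma config_poly_equispaced:
  assumes n: "n \<ge> 1"
  shows "config_poly n (equispaced n) = monom 1 n - 1"
proof (rule poly_eqI_degree_lead_coeff)
  have pow: "equispaced n k ^ n = 1" for k
  proof -
    have "equispaced n k ^ n = exp (of_nat n * (2 * of_nat k * of_real pi * \<i> / of_nat n))"
      unfolding equispaced_def by (rule exp_of_nat_mult[symmetric])
    also have "of_nat n * (2 * of_nat k * of_real pi * \<i> / of_nat n) = 2 * of_nat k * of_real pi * \<i>"
      using n by simp
    also have "exp \<dots> = 1"
      by (subst exp_eq_1) (auto intro: exI[of _ "int k"])
    finally show ?thesis .
  qed
  have inj: "inj_on (equispaced n) {1..n}"
  proof (rule inj_onI)
    fix j k assume jk: "j \<in> {1..n}" "k \<in> {1..n}" and "equispaced n j = equispaced n k"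
    then obtain m :: int where
      "2 * of_nat j * of_real pi * \<i> / of_nat n
        = 2 * of_nat k * of_real pi * \<i> / of_nat n + of_real (of_int (2 * m) * pi) * \<i>"
      unfolding equispaced_def exp_eq by blast
    then have "2 * of_real pi * \<i> * of_int (int j) = 2 * of_real pi * \<i> * (of_int (int k + m * int n) :: complex)"
      using n by (simp add: field_simps)
    then have "(of_int (int j) :: complex) = of_int (int k + m * int n)"
      by (simp only: mult_cancel_left) simp
    then have eq: "int j = int k + m * int n" by (simp only: of_int_eq_iff)
    \<comment> \<open>Two indices in \<open>{1..n}\<close> differ by less than \<open>n\<close>,
      which leaves only the multiple 0.\<close>
    have "\<bar>m * int n\<bar> < int n" using jk eq by auto
    then have "\<bar>m\<bar> * int n < 1 * int n" by (simp add: abs_mult)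
    then have "\<bar>m\<bar> < 1" by (rule mult_right_less_imp_less) simp
    then have "m = 0" by simp
    then show "j = k" using eq by simp
  qed
  show "card (equispaced n ` {1..n}) \<ge> n"
    unfolding card_image[OF inj] by simp
  show "coeff (config_poly n (equispaced n)) n = coeff (monom 1 n - 1) n"
    using n coeff_config_poly[of n "equispaced n"] by simp
  show "degree (config_poly n (equispaced n)) \<le> n"
    by (simp add: degree_config_poly)
  show "degree (monom 1 n - 1 :: complex poly) \<le> n"
    by (intro degree_diff_le) (auto simp: degree_monom_le)
  fix w assume "w \<in> equispaced n ` {1..n}"
  then obtain k where k: "k \<in> {1..n}" "w = equispaced n k" by auto
  then have "poly (config_poly n (equispaced n)) w = 0"
    unfolding poly_config_poly by (intro prod_zero) auto
  then show "poly (config_poly n (equispaced n)) w = poly (monom 1 n - 1) w"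
    by (simp add: k poly_monom pow)
qed

text \<open>Here the level polynomial is \<open>(\<zeta> - n) * w ^ n - \<zeta>\<close>, so all
  roots share one modulus: the case of equality below.\<close>

lemma level_poly_equispaced_root:
  assumes n: "n \<ge> 1" and \<zeta>: "\<zeta> \<noteq> of_nat n" and r: "poly (level_poly n (equispaced n) \<zeta>) r = 0"
  shows "norm r ^ n = norm \<zeta> / norm (\<zeta> - of_nat n)"
proof -
  have "poly (level_poly n (equispaced n) \<zeta>) r = \<zeta> * (r ^ n - 1) - of_nat n * (r * r ^ (n - 1))"
    using n by (simp add: level_poly_def config_poly_equispaced pderiv_diff pderiv_monom poly_monom)
  also have "r * r ^ (n - 1) = r ^ n" using n by (simp add: power_eq_if)
  finally have "r ^ n * (\<zeta> - of_nat n) = \<zeta>" using r by (simp add: algebra_simps)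
  then have "norm r ^ n * norm (\<zeta> - of_nat n) = norm \<zeta>" by (metis norm_mult norm_power)
  then show ?thesis using \<zeta> by (simp add: field_simps)
qed

section \<open>Comparison on circles\<close>

text \<open>This is \<open>w p'(w) / p(w)\<close> with \<open>p = config_poly n a\<close>. Thanks to
  the factor \<open>w\<close>, its level sets come from polynomials whose two extreme coefficients
  have moduli independent of \<open>a\<close>.\<close>

abbreviation euler_sum :: "nat \<Rightarrow> (nat \<Rightarrow> complex) \<Rightarrow> complex \<Rightarrow> complex" where
  "euler_sum n a w \<equiv> (\<Sum>k = 1..n. w / (w - a k))"

text \<open>Jensen's formula applied to numerator and denominator of
  \<open>\<zeta> - euler_sum n a w\<close>, the quotient of the level polynomial by the
  configuration polynomial.\<close>

lemma circle_ln_norm_level: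
  assumes n: "n \<ge> 1" and a: "unit_config n a" and z: "z \<noteq> 0" "norm z < 1" and \<zeta>: "\<zeta> \<noteq> of_nat n"
  obtains r where "\<And>i. i < n \<Longrightarrow> poly (level_poly n a \<zeta>) (r i) = 0"
    and "(\<Prod>i<n. norm (r i)) = norm \<zeta> / norm (\<zeta> - of_nat n)"
    and "(\<integral>u. ln (norm (\<zeta> - euler_sum n a (u * z))) \<partial>circle_measure)
      = ln (norm (\<zeta> - of_nat n)) + (\<Sum>i<n. ln (max (norm z) (norm (r i))))"
proof -
  obtain r where r: "\<And>w. poly (level_poly n a \<zeta>) w = (\<zeta> - of_nat n) * (\<Prod>i<n. w - r i)"
    and prod: "(\<Prod>i<n. norm (r i)) = norm \<zeta> / norm (\<zeta> - of_nat n)"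
    by (rule level_poly_decompose[OF n a \<zeta>]) blast
  have l: "\<zeta> - of_nat n \<noteq> 0" using \<zeta> by simp
  let ?q = "\<lambda>u. (\<zeta> - of_nat n) * (\<Prod>i<n. u * z - r i)"
  let ?p = "\<lambda>u. 1 * (\<Prod>k = 1..n. u * z - a k)"
  have q: "integrable circle_measure (\<lambda>u. ln (norm (?q u)))"
    "(\<integral>u. ln (norm (?q u)) \<partial>circle_measure)
      = ln (norm (\<zeta> - of_nat n)) + (\<Sum>i<n. ln (max (norm z) (norm (r i))))"
    by (rule circle_ln_norm_prod[OF z(1) l]; simp)+
  have p: "integrable circle_measure (\<lambda>u. ln (norm (?p u)))"
    "(\<integral>u. ln (norm (?p u)) \<partial>circle_measure) = ln (norm (1::complex)) + (\<Sum>k = 1..n. ln (max (norm z) (norm (a k))))"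
    by (rule circle_ln_norm_prod[OF z(1)]; simp)+
  \<comment> \<open>The denominator contributes nothing: it is monic and its zeros have modulus 1,
    above \<open>norm z\<close>.\<close>
  have "(\<Sum>k = 1..n. ln (max (norm z) (norm (a k)))) = 0"
    using a z by (intro sum.neutral) (auto simp: unit_config_def max_def)
  with p(2) have p0: "(\<integral>u. ln (norm (?p u)) \<partial>circle_measure) = 0" by simp
  have "AE u in circle_measure. \<forall>i\<in>{..<n}. u \<noteq> r i / z"
    using AE_circle_neq by (intro AE_finite_allI) auto
  then have AE: "AE u in circle_measure. ln (norm (\<zeta> - euler_sum n a (u * z))) = ln (norm (?q u)) - ln (norm (?p u))"
    using AE_circle_norm
  proof eventually_elim
    case (elim u)
    have ne: "u * z \<noteq> a k" if "k \<in> {1..n}" for k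
    proof
      assume "u * z = a k"
      then have "norm (u * z) = norm (a k)" by simp
      then show False using a z(2) elim(2) that by (simp add: unit_config_def norm_mult)
    qed
    have pn: "?p u \<noteq> 0" using ne by simp
    have "u * z - r i \<noteq> 0" if "i < n" for i using z(1) elim(1) that by (auto simp: field_simps)
    then have qn: "?q u \<noteq> 0" using l by simp
    have "?q u = (\<zeta> - euler_sum n a (u * z)) * ?p u"
      using poly_level_poly[of n "u * z" a \<zeta>, OF ne] by (simp add: r poly_config_poly)
    then have "\<zeta> - euler_sum n a (u * z) = ?q u / ?p u" using pn by (simp add: field_simps)
    then show ?case
      using pn qn by (simp only: norm_divide) (subst ln_div, auto)
  qed
  have "(\<integral>u. ln (norm (\<zeta> - euler_sum n a (u * z))) \<partial>circle_measure)
      = (\<integral>u. ln (norm (?q u)) - ln (norm (?p u)) \<partial>circle_measure)"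
    by (rule integral_cong_AE) (use AE in auto)
  also have "\<dots> = ln (norm (\<zeta> - of_nat n)) + (\<Sum>i<n. ln (max (norm z) (norm (r i))))"
    using q p p0 by (subst Bochner_Integration.integral_diff) auto
  finally show ?thesis
    using that[of r] prod r by (auto intro!: prod_zero)
qed

text \<open>Only the sum of \<open>ln (max (norm z) (norm (r i)))\<close> depends on the
  configuration, and the product \<open>t\<close> of the \<open>norm (r i)\<close> is fixed. The
  condition \<open>\<zeta> \<noteq> 0\<close> makes \<open>ln t\<close> meaningful.\<close>

lemma circle_ln_norm_level_ge:
  assumes n: "n \<ge> 1" and a: "unit_config n a" and z: "z \<noteq> 0" "norm z < 1"
    and \<zeta>: "\<zeta> \<noteq> of_nat n" "\<zeta> \<noteq> 0"
  shows "(\<integral>u. ln (norm (\<zeta> - euler_sum n (equispaced n) (u * z))) \<partial>circle_measure)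
    \<le> (\<integral>u. ln (norm (\<zeta> - euler_sum n a (u * z))) \<partial>circle_measure)"
proof -
  define t where "t = norm \<zeta> / norm (\<zeta> - of_nat n)"
  have t: "t > 0" using \<zeta> by (simp add: t_def)
  \<comment> \<open>The larger of two lower bounds, got by replacing every maximum by
    \<open>norm z\<close>, or every maximum by \<open>norm (r i)\<close>.\<close>
  define M where "M = max (real n * ln (norm z)) (ln t)"
  obtain r :: "nat \<Rightarrow> complex" where r: "(\<Prod>i<n. norm (r i)) = t"
    and int: "(\<integral>u. ln (norm (\<zeta> - euler_sum n a (u * z))) \<partial>circle_measure)
      = ln (norm (\<zeta> - of_nat n)) + (\<Sum>i<n. ln (max (norm z) (norm (r i))))"
    unfolding t_def by (rule circle_ln_norm_level[OF n a z \<zeta>(1)]) blast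
  have rpos: "norm (r i) > 0" if "i < n" for i
  proof (rule ccontr)
    assume "\<not> norm (r i) > 0"
    then have "(\<Prod>i<n. norm (r i)) = 0" using that by (intro prod_zero) auto
    then show False using r t by simp
  qed
  have "M \<le> (\<Sum>i<n. ln (max (norm z) (norm (r i))))"
    unfolding M_def
  proof (rule max.boundedI)
    have "real n * ln (norm z) = (\<Sum>i<n. ln (norm z))" by simp
    also have "\<dots> \<le> (\<Sum>i<n. ln (max (norm z) (norm (r i))))"
      using z by (intro sum_mono) (subst ln_le_cancel_iff, auto simp: less_max_iff_disj)
    finally show "real n * ln (norm z) \<le> (\<Sum>i<n. ln (max (norm z) (norm (r i))))" .
    have "ln t = (\<Sum>i<n. ln (norm (r i)))"
      using rpos unfolding r[symmetric] by (subst ln_prod) auto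
    also have "\<dots> \<le> (\<Sum>i<n. ln (max (norm z) (norm (r i))))"
      using z rpos by (intro sum_mono) (subst ln_le_cancel_iff, auto simp: less_max_iff_disj)
    finally show "ln t \<le> (\<Sum>i<n. ln (max (norm z) (norm (r i))))" .
  qed
  moreover obtain s where s: "\<And>i. i < n \<Longrightarrow> poly (level_poly n (equispaced n) \<zeta>) (s i) = 0"
    and ints: "(\<integral>u. ln (norm (\<zeta> - euler_sum n (equispaced n) (u * z))) \<partial>circle_measure)
      = ln (norm (\<zeta> - of_nat n)) + (\<Sum>i<n. ln (max (norm z) (norm (s i))))"
    by (rule circle_ln_norm_level[OF n unit_config_equispaced z \<zeta>(1)]) blast
  \<comment> \<open>The roots \<open>s i\<close> have equal moduli, so every maximum is decided the
    same way and the bound is attained.\<close>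
  moreover have "(\<Sum>i<n. ln (max (norm z) (norm (s i)))) = M"
  proof -
    have "ln (max (norm z) (norm (s i))) = M / n" if "i < n" for i
    proof -
      have si: "norm (s i) ^ n = t"
        unfolding t_def by (rule level_poly_equispaced_root[OF n \<zeta>(1) s[OF that]])
      then have spos: "norm (s i) > 0" using t n by (cases "s i = 0") (auto simp: power_0_left)
      have ln_t: "ln t = n * ln (norm (s i))" using spos by (simp add: si[symmetric] ln_realpow)
      show ?thesis
      proof (cases "norm z \<le> norm (s i)")
        case True
        then have "ln (norm z) \<le> ln (norm (s i))" using z spos by simp
        then show ?thesis using True n by (simp add: M_def ln_t max_absorb2 mult_left_mono)
      next
        case False
        then have "ln (norm (s i)) \<le> ln (norm z)" using z spos by simp
        then show ?thesis using False n by (simp add: M_def ln_t max_absorb1 mult_left_mono)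
      qed
    qed
    then show ?thesis using n by simp
  qed
  ultimately show ?thesis using int by simp
qed

text \<open>Supplies the bound on a fixed circle that the exchanges of integrals require.\<close>

lemma norm_euler_sum_le:
  assumes a: "unit_config n a" and z: "norm z < 1" and u: "norm u = 1"
  shows "norm (euler_sum n a (u * z)) \<le> n * (norm z / (1 - norm z))"
proof -
  have "norm (u * z / (u * z - a k)) \<le> norm z / (1 - norm z)" if "k \<in> {1..n}" for k
  proof -
    have "1 - norm z \<le> norm (u * z - a k)"
      using norm_triangle_ineq3[of "a k" "u * z"] a that u
      by (auto simp: unit_config_def norm_mult norm_minus_commute)
    then show ?thesis
      using z u by (auto simp: norm_divide norm_mult intro!: divide_left_mono mult_pos_pos)
  qed
  then have "norm (euler_sum n a (u * z)) \<le> (\<Sum>k = 1..n. norm z / (1 - norm z))"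
    by (intro sum_norm_le) auto
  then show ?thesis by simp
qed

text \<open>Averages the previous inequality over \<open>\<zeta> = v * \<rho>\<close>. The condition
  \<open>\<rho> \<noteq> real n\<close> keeps \<open>\<zeta>\<close> away from \<open>n\<close>,
  where the leading coefficient vanishes.\<close>

lemma circle_ln_max_ge:
  assumes n: "n \<ge> 1" and a: "unit_config n a" and z: "z \<noteq> 0" "norm z < 1"
    and \<rho>: "\<rho> > 0" "\<rho> \<noteq> real n"
  shows "(\<integral>u. ln (max \<rho> (norm (euler_sum n (equispaced n) (u * z)))) \<partial>circle_measure)
    \<le> (\<integral>u. ln (max \<rho> (norm (euler_sum n a (u * z)))) \<partial>circle_measure)"
proof -
  have meas: "(\<lambda>u. euler_sum n b (u * z)) \<in> borel_measurable borel" for b by measurable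
  have swap: "integrable circle_measure (\<lambda>v. \<integral>u. ln (norm (v * of_real \<rho> - euler_sum n b (u * z))) \<partial>circle_measure)"
    "(\<integral>u. ln (max \<rho> (norm (euler_sum n b (u * z)))) \<partial>circle_measure)
      = (\<integral>v. (\<integral>u. ln (norm (v * of_real \<rho> - euler_sum n b (u * z))) \<partial>circle_measure) \<partial>circle_measure)"
    if "unit_config n b" for b
    using circle_ln_norm_swap[OF meas norm_euler_sum_le[OF that z(2)] \<rho>(1)] by simp_all
  note e = unit_config_equispaced[of n]
  show ?thesis
    unfolding swap(2)[OF a] swap(2)[OF e]
  proof (rule integral_mono_AE[OF swap(1)[OF e] swap(1)[OF a]])
    show "AE v in circle_measure.
       (\<integral>u. ln (norm (v * of_real \<rho> - euler_sum n (equispaced n) (u * z))) \<partial>circle_measure)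
       \<le> (\<integral>u. ln (norm (v * of_real \<rho> - euler_sum n a (u * z))) \<partial>circle_measure)"
      using AE_circle_norm
    proof eventually_elim
      case (elim v)
      have "norm (v * of_real \<rho>) = \<rho>" using elim \<rho> by (simp add: norm_mult)
      then have "v * of_real \<rho> \<noteq> of_nat n" "v * of_real \<rho> \<noteq> 0" using \<rho> by auto
      then show ?case by (rule circle_ln_norm_level_ge[OF n a z])
    qed
  qed
qed

section \<open>From logarithmic means back to the mean modulus\<close>

interpretation circle_lborel: pair_sigma_finite circle_measure "lborel :: real measure" ..

text \<open>\<open>nn_integral_log_layer\<close> integrated over the circle; Tonelli applies since
  the integrand is nonnegative.\<close>

lemma circle_norm_layer:
  fixes g :: "complex \<Rightarrow> complex"
  assumes g [measurable]: "g \<in> borel_measurable borel"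
    and C: "\<And>u. norm u = 1 \<Longrightarrow> norm (g u) \<le> C"
  shows "(\<integral>\<^sup>+u. ennreal (norm (g u)) \<partial>circle_measure)
    = (\<integral>\<^sup>+s. ennreal (exp (- s) * ((\<integral>u. ln (max (exp (- s)) (norm (g u))) \<partial>circle_measure) + s)) \<partial>lborel)"
proof -
  have "(\<integral>\<^sup>+u. ennreal (norm (g u)) \<partial>circle_measure)
      = (\<integral>\<^sup>+u. (\<integral>\<^sup>+s. ennreal (exp (- s) * (ln (max (exp (- s)) (norm (g u))) + s)) \<partial>lborel) \<partial>circle_measure)"
    by (simp add: nn_integral_log_layer)
  also have "\<dots> = (\<integral>\<^sup>+s. (\<integral>\<^sup>+u. ennreal (exp (- s) * (ln (max (exp (- s)) (norm (g u))) + s)) \<partial>circle_measure) \<partial>lborel)"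
    by (rule circle_lborel.Fubini'[symmetric]) measurable
  also have "\<dots> = (\<integral>\<^sup>+s. ennreal (exp (- s) * ((\<integral>u. ln (max (exp (- s)) (norm (g u))) \<partial>circle_measure) + s)) \<partial>lborel)"
  proof (rule nn_integral_cong)
    fix s :: real
    have int: "integrable circle_measure (\<lambda>u. ln (max (exp (- s)) (norm (g u))))"
      by (rule integrable_ln_max[OF g C]) auto
    have "0 \<le> ln (max (exp (- s)) x) + s" for x
    proof -
      have "ln (exp (- s)) \<le> ln (max (exp (- s)) x)"
        by (subst ln_le_cancel_iff) (auto simp: less_max_iff_disj)
      then show ?thesis by simp
    qed
    then show "(\<integral>\<^sup>+u. ennreal (exp (- s) * (ln (max (exp (- s)) (norm (g u))) + s)) \<partial>circle_measure)
        = ennreal (exp (- s) * ((\<integral>u. ln (max (exp (- s)) (norm (g u))) \<partial>circle_measure) + s))"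
      using int by (subst nn_integral_eq_integral) auto
  qed
  finally show ?thesis .
qed

lemma circle_norm_euler_sum_ge:
  assumes n: "n \<ge> 1" and a: "unit_config n a" and z: "z \<noteq> 0" "norm z < 1"
  shows "(\<integral>\<^sup>+u. ennreal (norm (euler_sum n (equispaced n) (u * z))) \<partial>circle_measure)
    \<le> (\<integral>\<^sup>+u. ennreal (norm (euler_sum n a (u * z))) \<partial>circle_measure)"
proof -
  have meas: "(\<lambda>u. euler_sum n b (u * z)) \<in> borel_measurable borel" for b by measurable
  have layer: "(\<integral>\<^sup>+u. ennreal (norm (euler_sum n b (u * z))) \<partial>circle_measure)
    = (\<integral>\<^sup>+s. ennreal (exp (- s) *
        ((\<integral>u. ln (max (exp (- s)) (norm (euler_sum n b (u * z)))) \<partial>circle_measure) + s)) \<partial>lborel)"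
    if "unit_config n b" for b
    by (rule circle_norm_layer[OF meas norm_euler_sum_le[OF that z(2)]])
  \<comment> \<open>This excludes the one radius \<open>exp (- s) = n\<close> that the comparison
    leaves out.\<close>
  have AE: "AE s in lborel. s \<noteq> - ln (real n)" by (rule AE_lborel_singleton)
  show ?thesis
    unfolding layer[OF a] layer[OF unit_config_equispaced]
  proof (rule nn_integral_mono_AE, use AE in eventually_elim)
    case (elim s)
    have "exp (- s) \<noteq> real n" using elim by (metis ln_exp minus_minus)
    then have "(\<integral>u. ln (max (exp (- s)) (norm (euler_sum n (equispaced n) (u * z)))) \<partial>circle_measure)
      \<le> (\<integral>u. ln (max (exp (- s)) (norm (euler_sum n a (u * z)))) \<partial>circle_measure)"
      by (intro circle_ln_max_ge[OF n a z]) auto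
    then show ?case by (intro ennreal_leI mult_left_mono) auto
  qed
qed

text \<open>Dividing the Euler sum by \<open>w = u * z\<close> divides its modulus by the constant
  \<open>norm z\<close>.\<close>

lemma circle_norm_sum_inverse_ge:
  assumes n: "n \<ge> 1" and a: "unit_config n a" and z: "z \<noteq> 0" "norm z < 1"
  shows "(\<integral>\<^sup>+u. ennreal (norm (\<Sum>k = 1..n. 1 / (u * z - equispaced n k))) \<partial>circle_measure)
    \<le> (\<integral>\<^sup>+u. ennreal (norm (\<Sum>k = 1..n. 1 / (u * z - a k))) \<partial>circle_measure)"
proof -
  have eq: "(\<integral>\<^sup>+u. ennreal (norm (\<Sum>k = 1..n. 1 / (u * z - b k))) \<partial>circle_measure)
      = ennreal (1 / norm z) * (\<integral>\<^sup>+u. ennreal (norm (euler_sum n b (u * z))) \<partial>circle_measure)" for b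
  proof -
    have "(\<integral>\<^sup>+u. ennreal (norm (\<Sum>k = 1..n. 1 / (u * z - b k))) \<partial>circle_measure)
        = (\<integral>\<^sup>+u. ennreal (1 / norm z) * ennreal (norm (euler_sum n b (u * z))) \<partial>circle_measure)"
    proof (rule nn_integral_cong_AE, use AE_circle_norm in eventually_elim)
      case (elim u)
      have "euler_sum n b (u * z) = u * z * (\<Sum>k = 1..n. 1 / (u * z - b k))"
        by (simp add: sum_distrib_left)
      then have eq: "norm (\<Sum>k = 1..n. 1 / (u * z - b k)) = 1 / norm z * norm (euler_sum n b (u * z))"
        using z elim by (simp add: norm_mult)
      show ?case unfolding eq by (rule ennreal_mult') simp
    qed
    also have "\<dots> = ennreal (1 / norm z) * (\<integral>\<^sup>+u. ennreal (norm (euler_sum n b (u * z))) \<partial>circle_measure)"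
      by (rule nn_integral_cmult) measurable
    finally show ?thesis .
  qed
  show ?thesis
    unfolding eq by (intro mult_left_mono circle_norm_euler_sum_ge[OF n a z]) auto
qed

section \<open>From circles to the disc\<close>

interpretation lborel_circle: pair_sigma_finite "lborel :: complex measure" circle_measure ..

text \<open>The area integral is unchanged when \<open>z\<close> is replaced by
  \<open>u * z\<close>. Averaging over \<open>u\<close> and exchanging integrals exhibits it as an
  integral of circular means.\<close>

lemma ennreal_chui_integral:
  assumes a: "unit_config n a"
  shows "ennreal (chui_integral n a) = (\<integral>\<^sup>+z. indicator (cball 0 1) z *
    (\<integral>\<^sup>+u. ennreal (norm (\<Sum>k = 1..n. 1 / (u * z - a k))) \<partial>circle_measure) \<partial>lborel)"
proof -
  define G where "G z = indicator (cball 0 1) z * ennreal (norm (\<Sum>k = 1..n. 1 / (z - a k)))" for z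
  have [measurable]: "G \<in> borel_measurable borel"
  proof -
    have [measurable]: "cball (0::complex) 1 \<in> sets borel" by simp
    show ?thesis unfolding G_def by measurable
  qed
  have "ennreal (chui_integral n a) = (\<integral>\<^sup>+z. ennreal (indicator (cball 0 1) z *\<^sub>R norm (\<Sum>k = 1..n. 1 / (z - a k))) \<partial>lborel)"
    using set_integrable_chui[OF a]
    unfolding chui_integral_def set_lebesgue_integral_def set_integrable_def
    by (intro nn_integral_eq_integral[symmetric]) auto
  also have "\<dots> = (\<integral>\<^sup>+z. G z \<partial>lborel)"
    by (intro nn_integral_cong) (auto simp: G_def indicator_def)
  \<comment> \<open>A constant is its own mean, as \<open>circle_measure\<close> has total mass
    1.\<close>
  also have "\<dots> = (\<integral>\<^sup>+u. (\<integral>\<^sup>+z. G z \<partial>lborel) \<partial>circle_measure)"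
    using circle.emeasure_space_1 by simp
  also have "\<dots> = (\<integral>\<^sup>+u. (\<integral>\<^sup>+z. G (u * z) \<partial>lborel) \<partial>circle_measure)"
    by (rule nn_integral_cong_AE, use AE_circle_norm in eventually_elim)
      (simp add: nn_integral_lborel_rotate)
  also have "\<dots> = (\<integral>\<^sup>+z. (\<integral>\<^sup>+u. G (u * z) \<partial>circle_measure) \<partial>lborel)"
    by (rule lborel_circle.Fubini') measurable
  also have "\<dots> = (\<integral>\<^sup>+z. indicator (cball 0 1) z *
    (\<integral>\<^sup>+u. ennreal (norm (\<Sum>k = 1..n. 1 / (u * z - a k))) \<partial>circle_measure) \<partial>lborel)"
  proof (rule nn_integral_cong)
    fix z :: complex
    have "(\<integral>\<^sup>+u. G (u * z) \<partial>circle_measure)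
        = (\<integral>\<^sup>+u. indicator (cball 0 1) z * ennreal (norm (\<Sum>k = 1..n. 1 / (u * z - a k))) \<partial>circle_measure)"
      by (rule nn_integral_cong_AE, use AE_circle_norm in eventually_elim)
        (simp add: G_def indicator_def norm_mult)
    also have "\<dots> = indicator (cball 0 1) z * (\<integral>\<^sup>+u. ennreal (norm (\<Sum>k = 1..n. 1 / (u * z - a k))) \<partial>circle_measure)"
      by (rule nn_integral_cmult) measurable
    finally show "(\<integral>\<^sup>+u. G (u * z) \<partial>circle_measure) = indicator (cball 0 1) z *
      (\<integral>\<^sup>+u. ennreal (norm (\<Sum>k = 1..n. 1 / (u * z - a k))) \<partial>circle_measure)" .
  qed
  finally show ?thesis .
qed

lemma AE_lborel_norm_neq:
  fixes c :: real
  shows "AE z::'a::euclidean_space in lborel. norm z \<noteq> c"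
proof -
  have "sphere (0::'a) c \<in> null_sets lebesgue"
    using negligible_sphere negligible_iff_null_sets by blast
  then have "sphere (0::'a) c \<in> null_sets lborel"
    by (simp add: null_sets_completion_iff)
  from AE_not_in[OF this] show ?thesis by simp
qed

theorem mainTheorem2:
  fixes n :: nat
  assumes "n \<ge> 1"
  shows "is_arg_min (chui_integral n) (unit_config n) (equispaced n)"
  unfolding is_arg_min_linorder
proof (intro conjI allI impI)
  show "unit_config n (equispaced n)" by (rule unit_config_equispaced)
  fix a assume a: "unit_config n a"
  have "ennreal (chui_integral n (equispaced n)) \<le> ennreal (chui_integral n a)"
    unfolding ennreal_chui_integral[OF a] ennreal_chui_integral[OF unit_config_equispaced]
  proof (rule nn_integral_mono_AE)
    \<comment> \<open>The comparison on circles holds for \<open>0 < norm z < 1\<close>; the centre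
      and the boundary circle are null sets.\<close>
    have "AE z in lborel. (z::complex) \<noteq> 0 \<and> norm z \<noteq> 1"
      using AE_lborel_singleton AE_lborel_norm_neq by eventually_elim simp
    then show "AE z in lborel. indicator (cball 0 1) z *
        (\<integral>\<^sup>+u. ennreal (norm (\<Sum>k = 1..n. 1 / (u * z - equispaced n k))) \<partial>circle_measure)
      \<le> indicator (cball 0 1) z *
        (\<integral>\<^sup>+u. ennreal (norm (\<Sum>k = 1..n. 1 / (u * z - a k))) \<partial>circle_measure)"
    proof eventually_elim
      case (elim z)
      then show ?case
        using circle_norm_sum_inverse_ge[OF assms a, of z]
        by (cases "norm z < 1") (auto simp: indicator_def)
    qed
  qed
  \<comment> \<open>\<open>ennreal\<close> sends negative numbers to 0, so it reflects the order
    only below a nonnegative right-hand side.\<close>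
  moreover have "0 \<le> chui_integral n a"
    unfolding chui_integral_def set_lebesgue_integral_def by (intro integral_nonneg_AE) auto
  ultimately show "chui_integral n (equispaced n) \<le> chui_integral n a" by simp
qed

end
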